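(* Let $x_0\in\mathbb{E}$, $v_0=x_0$, $A_0=0$, and for all $k\ge1$ let $a_k=\frac{k}{L_f}$, $A_k=\frac{k(k+1)}{2L_f}$. Let the sequences $(y_k)_{k\ge1}$, $(x_k)_{k\ge1}$, $(v_k)_{k\ge1}$ be generated, for $k\ge0$, by $$A_{k+1}y_{k+1}=A_kx_k+a_{k+1}v_k,\qquad x_{k+1}=y_{k+1}-\frac{1}{L_f}B^{-1}\nabla f(y_{k+1}),\qquad v_{k+1}=v_k-a_{k+1}B^{-1}\nabla f(y_{k+1}).$$ Then for every $x^*\in X^*$ and every $k\ge1$, $$f(x_k)-f(x^* )\le\frac{L_f\|x_0-x^*\|^2}{k(k+1)} .$$
   Context: $\mathbb{E}$ is an $n$-dimensional real vector space, $\mathbb{E}^*$ its dual, $\langle s,x\rangle$ the value of $s\in\mathbb{E}^*$ at $x\in\mathbb{E}$. $B:\mathbb{E}\to\mathbb{E}^*$ is a symmetric positive definite linear operator, $\|x\|=\sqrt{\langle Bx,x\rangle}$ on $\mathbb{E}$ and $\|g\|_*=\sqrt{\langle g,B^{-1}g\rangle}$ on $\mathbb{E}^*$. $f:\mathbb{E}\to\mathbb{R}$ is convex and differentiable, with gradient Lipschitz continuous with constant $L_f>0$ (i.e. $\|\nabla f(x)-\nabla f(y)\|_*\le L_f\|x-y\|$). The set $X^*$ of minimizers of $f$ over $\mathbb{E}$ is non-empty. *)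

theory Defs
  imports "HOL-Analysis.Analysis"
begin

text \<open>
  The space is a type \<open>'a::euclidean_space\<close>, its dual is the type \<open>'a \<Rightarrow>\<^sub>L real\<close> of bounded
  linear functionals (in finite dimension every linear functional is bounded), and the value
  of \<open>s\<close> at \<open>x\<close> is \<open>blinfun_apply s x\<close>. The inner product and norm of the type class are
  auxiliary: they supply only the (unique) topology of the finite-dimensional space. The
  norms of the theory are the ones induced by the operator \<open>B\<close> below.
\<close>

definition sym_pos_def :: "('a::euclidean_space \<Rightarrow> ('a \<Rightarrow>\<^sub>L real)) \<Rightarrow> bool" where
  "sym_pos_def B \<longleftrightarrow>
     linear B \<and>
     (\<forall>x y. blinfun_apply (B x) y = blinfun_apply (B y) x) \<and>
     (\<forall>x. x \<noteq> 0 \<longrightarrow> blinfun_apply (B x) x > 0)"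

definition primal_norm :: "('a::euclidean_space \<Rightarrow> ('a \<Rightarrow>\<^sub>L real)) \<Rightarrow> 'a \<Rightarrow> real" where
  "primal_norm B x = sqrt (blinfun_apply (B x) x)"

definition dual_norm :: "('a::euclidean_space \<Rightarrow> ('a \<Rightarrow>\<^sub>L real)) \<Rightarrow> ('a \<Rightarrow>\<^sub>L real) \<Rightarrow> real" where
  "dual_norm B g = sqrt (blinfun_apply g (inv B g))"

text \<open>The gradient is an element of the dual space; it is meaningful where \<open>f\<close> is differentiable.\<close>

definition gradient :: "('a::euclidean_space \<Rightarrow> real) \<Rightarrow> 'a \<Rightarrow> ('a \<Rightarrow>\<^sub>L real)" where
  "gradient f x = Blinfun (frechet_derivative f (at x))"

definition minimizers :: "('a \<Rightarrow> real) \<Rightarrow> 'a set" where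
  "minimizers f = {x. \<forall>z. f x \<le> f z}"

lemma gradient_has_derivative:
  assumes "f differentiable (at x)"
  shows "(f has_derivative blinfun_apply (gradient f x)) (at x)"
proof -
  have d: "(f has_derivative frechet_derivative f (at x)) (at x)"
    using assms by (simp add: frechet_derivative_works)
  then show ?thesis
    by (simp add: gradient_def bounded_linear_Blinfun_apply has_derivative_bounded_linear)
qed

lemma sym_pos_def_bij:
  fixes B :: "'a::euclidean_space \<Rightarrow> ('a \<Rightarrow>\<^sub>L real)"
  assumes "sym_pos_def B"
  shows "bij B"
proof -
  have lin: "linear B" and pos: "\<And>x. x \<noteq> 0 \<Longrightarrow> blinfun_apply (B x) x > 0"
    using assms by (auto simp: sym_pos_def_def)
  define R where "R s = (\<Sum>b\<in>Basis. blinfun_apply s b *\<^sub>R b)" for s :: "'a \<Rightarrow>\<^sub>L real"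
  have R: "R s \<bullet> b = blinfun_apply s b" if "b \<in> Basis" for s b
    using that by (simp add: R_def)
  have injR: "s = t" if "R s = R t" for s t
    by (rule blinfun_euclidean_eqI) (metis R that)
  have linR: "linear R"
    by (rule linearI)
      (simp_all add: R_def blinfun.add_left blinfun.scaleR_left scaleR_add_left
        sum.distrib scaleR_sum_right)
  have injB: "inj B"
  proof (subst linear_injective_0[OF lin], intro allI impI)
    fix x assume "B x = 0"
    then show "x = 0" using pos[of x] by force
  qed
  have "inj (R \<circ> B)"
    using injB injR by (auto simp: inj_def)
  moreover have "linear (R \<circ> B)"
    using lin linR by (rule linear_compose)
  ultimately have "surj (R \<circ> B)"
    using linear_injective_imp_surjective by blast
  then have "\<exists>x. R (B x) = R s" for s
    by (metis comp_apply surjD)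
  then have "surj B"
    using injR by (metis surjI surj_def)
  with injB show ?thesis by (simp add: bij_def)
qed

end

(*
  The estimating argument does not work with f (x k) itself but with the surrogate
  phi k = f (y k) - |grad f (y k)|^2 / (2 L), which dominates f (x k) by the descent lemma.
  Cocoercivity, f z >= f w + <grad f w, z - w> + |grad f z - grad f w|^2 / (2 L), at z = y k and
  w = y (k + 1) turns into phi k >= phi (k + 1) + <grad f w, x k - w> + |grad f w|^2 / L; the
  minimizer satisfies the same inequality.  The gain |grad f w|^2 / L is twice that of the usual
  analysis, so A k * phi k + |v k - xstar|^2 / 2, with f xstar subtracted from phi k, is
  nonincreasing as soon as L * (a k)^2 <= 2 * A k, which the present long steps satisfy.
*)
theory Submission
  imports Defs
begin

section \<open>Norms induced by \<open>B\<close>, and duality between them\<close>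

locale spd_operator =
  fixes B :: "'a::euclidean_space \<Rightarrow> ('a \<Rightarrow>\<^sub>L real)"
  assumes spd: "sym_pos_def B"
begin

lemma linear_B: "linear B"
  using spd by (simp add: sym_pos_def_def)

lemmas B_simps =
  linear_add[OF linear_B] linear_diff[OF linear_B] linear_scale[OF linear_B]
  linear_0[OF linear_B] linear_neg[OF linear_B]
  blinfun.bilinear_simps

lemma B_sym: "blinfun_apply (B p) q = blinfun_apply (B q) p"
  using spd unfolding sym_pos_def_def by blast

lemma B_nonneg: "0 \<le> blinfun_apply (B p) p"
  using spd by (cases "p = 0") (auto simp: sym_pos_def_def less_imp_le B_simps)

lemma B_inv [simp]: "B (inv B s) = s"
  using sym_pos_def_bij[OF spd] by (simp add: bij_is_surj surj_f_inv_f)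

lemma primal_norm_square: "(primal_norm B p)\<^sup>2 = blinfun_apply (B p) p"
  by (simp add: primal_norm_def B_nonneg)

lemma primal_norm_nonneg: "0 \<le> primal_norm B p"
  by (simp add: primal_norm_def B_nonneg)

lemma primal_norm_scaleR: "primal_norm B (t *\<^sub>R p) = \<bar>t\<bar> * primal_norm B p"
  by (simp add: primal_norm_def B_simps real_sqrt_mult)

lemma dual_norm_square: "(dual_norm B s)\<^sup>2 = blinfun_apply s (inv B s)"
  using B_nonneg[of "inv B s"] by (simp add: dual_norm_def)

lemma dual_norm_eq: "dual_norm B s = primal_norm B (inv B s)"
  by (simp add: dual_norm_def primal_norm_def)

lemma Cauchy_Schwarz_B: "blinfun_apply (B p) q \<le> primal_norm B p * primal_norm B q"
proof -
  define m n c where "m = blinfun_apply (B p) p" and "n = blinfun_apply (B q) q"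
    and "c = blinfun_apply (B p) q"
  \<comment> \<open>The test vector is \<open>n\<close> times the component of \<open>p\<close> that
    is \<open>B\<close>-orthogonal to \<open>q\<close>; the factor \<open>n\<close> avoids a
    division.\<close>
  have q: "0 \<le> m * n * n - c * c * n"
    using B_nonneg[of "n *\<^sub>R p - c *\<^sub>R q"]
    by (simp add: B_simps m_def n_def c_def B_sym[of q p] algebra_simps)
  have "c\<^sup>2 \<le> m * n"
  proof (cases "q = 0")
    case True
    then show ?thesis by (simp add: c_def n_def B_simps)
  next
    case False
    then have "0 < n" using spd by (simp add: n_def sym_pos_def_def)
    moreover have "0 \<le> n * (m * n - c\<^sup>2)"
      using q by (simp add: algebra_simps power2_eq_square)
    ultimately show ?thesis by (simp add: zero_le_mult_iff)
  qed
  then have "c \<le> sqrt (m * n)" by (rule real_le_rsqrt)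
  then show ?thesis
    by (simp add: primal_norm_def real_sqrt_mult m_def n_def c_def)
qed

lemma dual_norm_Cauchy_Schwarz: "blinfun_apply s q \<le> dual_norm B s * primal_norm B q"
  using Cauchy_Schwarz_B[of "inv B s" q] by (simp add: dual_norm_eq)

end

section \<open>Restriction to lines\<close>

lemma has_real_derivative_along_line:
  assumes "f differentiable (at (z + t *\<^sub>R d))"
  shows "((\<lambda>t. f (z + t *\<^sub>R d)) has_real_derivative
           blinfun_apply (gradient f (z + t *\<^sub>R d)) d) (at t within S)"
proof -
  have "((\<lambda>t. z + t *\<^sub>R d) has_derivative (\<lambda>h. h *\<^sub>R d)) (at t within S)"
    by (auto intro!: derivative_eq_intros)
  from has_derivative_compose[OF this gradient_has_derivative[OF assms]]
  show ?thesis
    by (simp add: has_field_derivative_def blinfun.scaleR_right mult_commute_abs)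
qed

text \<open>On the line through \<open>w\<close> and \<open>u\<close> this is the one-variable
  tangent inequality at parameter 0, evaluated at parameter 1.\<close>

lemma convex_above_gradient_tangent:
  assumes conv: "convex_on UNIV f" and diff: "f differentiable (at w)"
  shows "f w + blinfun_apply (gradient f w) (u - w) \<le> f u"
proof -
  define h where "h t = f (w + t *\<^sub>R (u - w))" for t :: real
  have "convex_on UNIV h"
  proof (rule convex_onI)
    fix t r s :: real assume t: "0 < t" "t < 1"
    have "w + ((1 - t) *\<^sub>R r + t *\<^sub>R s) *\<^sub>R (u - w)
        = (1 - t) *\<^sub>R (w + r *\<^sub>R (u - w)) + t *\<^sub>R (w + s *\<^sub>R (u - w))"
      by (simp add: algebra_simps)
    then show "h ((1 - t) *\<^sub>R r + t *\<^sub>R s) \<le> (1 - t) * h r + t * h s"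
      unfolding h_def using convex_onD[OF conv, of t] t by simp
  qed simp
  moreover have "(h has_real_derivative blinfun_apply (gradient f w) (u - w)) (at 0)"
    using has_real_derivative_along_line[of f w 0 "u - w" UNIV] diff by (simp add: h_def[abs_def])
  ultimately have "blinfun_apply (gradient f w) (u - w) * (1 - 0) \<le> h 1 - h 0"
    by (intro convex_on_imp_above_tangent[where A = UNIV]) auto
  then show ?thesis by (simp add: h_def)
qed

section \<open>Consequences of a Lipschitz gradient\<close>

locale lipschitz_gradient = spd_operator B
  for B :: "'a::euclidean_space \<Rightarrow> ('a \<Rightarrow>\<^sub>L real)" +
  fixes f :: "'a \<Rightarrow> real" and L :: real
  assumes diff: "f differentiable (at z)"
    and L_pos: "L > 0"
    and lipschitz: "dual_norm B (gradient f z - gradient f w) \<le> L * primal_norm B (z - w)"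
begin

text \<open>Along the segment, the gap between \<open>f\<close> and the quadratic bound has
  derivative at most 0, by Cauchy-Schwarz and the Lipschitz bound.\<close>

lemma descent:
  "f (z + d) \<le> f z + blinfun_apply (gradient f z) d + L / 2 * (primal_norm B d)\<^sup>2"
proof -
  define h where "h t = f (z + t *\<^sub>R d) - t * blinfun_apply (gradient f z) d
                        - L / 2 * t\<^sup>2 * (primal_norm B d)\<^sup>2" for t :: real
  have "h 1 \<le> h 0"
  proof (rule DERIV_nonpos_imp_nonincreasing[of 0 1 h])
    fix t :: real assume t: "0 \<le> t" "t \<le> 1"
    let ?s = "gradient f (z + t *\<^sub>R d) - gradient f z"
    have "blinfun_apply ?s d \<le> dual_norm B ?s * primal_norm B d"
      by (rule dual_norm_Cauchy_Schwarz)
    also have "\<dots> \<le> L * primal_norm B (t *\<^sub>R d) * primal_norm B d"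
      using lipschitz[of "z + t *\<^sub>R d" z] by (intro mult_right_mono primal_norm_nonneg) simp
    also have "\<dots> = L * t * (primal_norm B d)\<^sup>2"
      using t by (simp add: primal_norm_scaleR power2_eq_square)
    finally have "blinfun_apply ?s d - L * t * (primal_norm B d)\<^sup>2 \<le> 0" by simp
    moreover have "(h has_real_derivative blinfun_apply ?s d - L * t * (primal_norm B d)\<^sup>2) (at t)"
      unfolding h_def
      by (auto intro!: derivative_eq_intros has_real_derivative_along_line diff
               simp: blinfun.diff_left)
    ultimately show "\<exists>y. (h has_real_derivative y) (at t) \<and> y \<le> 0" by blast
  qed simp
  then show ?thesis by (simp add: h_def)
qed

text \<open>The direction \<open>s\<close> is left free: cocoercivity takes a difference of
  gradients, the method itself takes \<open>gradient f z\<close>.\<close>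

lemma gradient_step_decrease:
  "f (z - (1 / L) *\<^sub>R inv B s)
     \<le> f z - blinfun_apply (gradient f z) (inv B s) / L + (dual_norm B s)\<^sup>2 / (2 * L)"
proof -
  have "(primal_norm B (- ((1 / L) *\<^sub>R inv B s)))\<^sup>2 = (dual_norm B s)\<^sup>2 / L\<^sup>2"
    by (simp add: primal_norm_square dual_norm_square B_simps) (simp add: power2_eq_square)
  then show ?thesis
    using descent[of z "- ((1 / L) *\<^sub>R inv B s)"] L_pos
    by (simp add: blinfun.bilinear_simps power2_eq_square)
qed

text \<open>Subtracting from \<open>f\<close> its tangent at \<open>w\<close> leaves a function with
  minimum at \<open>w\<close> and gradient \<open>?s\<close> at \<open>z\<close>. A gradient step
  from \<open>z\<close> lowers it by at least \<open>(dual_norm B ?s)\<^sup>2 / (2 * L)\<close>, but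
  not below that minimum.\<close>

lemma cocoercive:
  assumes conv: "convex_on UNIV f"
  shows "f w + blinfun_apply (gradient f w) (z - w)
           + (dual_norm B (gradient f z - gradient f w))\<^sup>2 / (2 * L) \<le> f z"
proof -
  let ?s = "gradient f z - gradient f w"
  have "f w + blinfun_apply (gradient f w) (z - (1 / L) *\<^sub>R inv B ?s - w)
      \<le> f (z - (1 / L) *\<^sub>R inv B ?s)"
    by (rule convex_above_gradient_tangent[OF conv diff])
  also have "\<dots> \<le> f z - blinfun_apply (gradient f z) (inv B ?s) / L
                    + (dual_norm B ?s)\<^sup>2 / (2 * L)"
    by (rule gradient_step_decrease)
  finally show ?thesis
    using L_pos
    by (simp add: dual_norm_square blinfun.bilinear_simps diff_divide_distrib)
qed

section \<open>The surrogate and the potential\<close>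

definition surrogate :: "'a \<Rightarrow> real" where
  "surrogate z = f z - (dual_norm B (gradient f z))\<^sup>2 / (2 * L)"

lemma gradient_step_le_surrogate:
  "f (z - (1 / L) *\<^sub>R inv B (gradient f z)) \<le> surrogate z"
  using gradient_step_decrease[of z "gradient f z"] L_pos
  by (simp add: surrogate_def dual_norm_square field_simps)

text \<open>Expand the square in cocoercivity: the cross term moves \<open>z\<close> to its gradient
  step, the square at \<open>z\<close> goes into \<open>surrogate z\<close>, and the square at
  \<open>w\<close> joins the equal term from replacing \<open>f w\<close> by
  \<open>surrogate w\<close>.\<close>

lemma surrogate_above_tangent:
  assumes conv: "convex_on UNIV f"
  shows "surrogate w + blinfun_apply (gradient f w) (z - (1 / L) *\<^sub>R inv B (gradient f z) - w)
           + (dual_norm B (gradient f w))\<^sup>2 / L \<le> surrogate z"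
proof -
  have "blinfun_apply (gradient f z) (inv B (gradient f w))
      = blinfun_apply (gradient f w) (inv B (gradient f z))"
    using B_sym[of "inv B (gradient f z)" "inv B (gradient f w)"] by simp
  moreover have "inv B (gradient f z - gradient f w) = inv B (gradient f z) - inv B (gradient f w)"
    using sym_pos_def_bij[OF spd]
    by (intro inv_f_eq) (auto simp: bij_is_inj linear_diff[OF linear_B])
  ultimately have "(dual_norm B (gradient f z - gradient f w))\<^sup>2
      = (dual_norm B (gradient f z))\<^sup>2 + (dual_norm B (gradient f w))\<^sup>2
        - 2 * blinfun_apply (gradient f w) (inv B (gradient f z))"
    by (simp add: dual_norm_square blinfun.bilinear_simps)
  then show ?thesis
    using cocoercive[OF conv, of w z] L_pos
    by (simp add: surrogate_def blinfun.bilinear_simps add_divide_distrib diff_divide_distrib)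
qed

lemma gradient_minimizer:
  assumes "xs \<in> minimizers f"
  shows "gradient f xs = 0"
proof -
  have "frechet_derivative f (at xs) = (\<lambda>h. 0)"
    using assms diff[of xs]
    by (intro differential_zero_maxmin[of xs UNIV f])
       (auto simp: minimizers_def frechet_derivative_works)
  then show ?thesis
    by (simp add: gradient_def zero_blinfun_def)
qed

lemma inv_B_0: "inv B 0 = 0"
  using sym_pos_def_bij[OF spd] by (intro inv_f_eq) (auto simp: bij_is_inj linear_0[OF linear_B])

lemma surrogate_minimizer:
  assumes "xs \<in> minimizers f"
  shows "surrogate xs = f xs"
  by (simp add: surrogate_def gradient_minimizer[OF assms] dual_norm_square)

text \<open>The case \<open>A0 = 0\<close> is the first step, where \<open>y 0\<close> (here \<open>z\<close>) is arbitrary and \<open>x 0\<close> is not a gradient step.\<close>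

lemma potential_step:
  assumes conv: "convex_on UNIV f" and xs: "xs \<in> minimizers f"
    and A0: "0 \<le> A0" and a: "0 \<le> a" and A1: "A1 = A0 + a" "L * a\<^sup>2 \<le> 2 * A1"
    and w: "A1 *\<^sub>R w = A0 *\<^sub>R xc + a *\<^sub>R vc"
    and xc: "A0 = 0 \<or> xc = z - (1 / L) *\<^sub>R inv B (gradient f z)"
  defines "v1 \<equiv> vc - a *\<^sub>R inv B (gradient f w)"
  shows "A1 * (surrogate w - f xs) + (primal_norm B (v1 - xs))\<^sup>2 / 2
       \<le> A0 * (surrogate z - f xs) + (primal_norm B (vc - xs))\<^sup>2 / 2"
proof -
  define g where "g = gradient f w"
  define G where "G = (dual_norm B g)\<^sup>2"
  have 1: "A0 * (surrogate w + blinfun_apply g (xc - w) + G / L) \<le> A0 * surrogate z"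
  proof (cases "A0 = 0")
    case False
    then show ?thesis
      using xc surrogate_above_tangent[OF conv, of w z] A0
      by (auto simp: g_def G_def intro!: mult_left_mono)
  qed simp
  \<comment> \<open>The gradient vanishes at \<open>xs\<close>, so its gradient step is
    \<open>xs\<close> itself.\<close>
  have 2: "a * (surrogate w + blinfun_apply g (xs - w) + G / L) \<le> a * f xs"
    using surrogate_above_tangent[OF conv, of w xs] a
    by (intro mult_left_mono)
       (simp_all add: g_def G_def surrogate_minimizer[OF xs] gradient_minimizer[OF xs] inv_B_0)
  \<comment> \<open>The choice of \<open>w\<close> trades \<open>xc\<close> for \<open>vc\<close>,
    producing the cross term of the expanded square in \<open>4\<close>, which then cancels.\<close>
  have "A0 * blinfun_apply g (xc - w) + a * blinfun_apply g (xs - w)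
      = blinfun_apply g (A0 *\<^sub>R xc + a *\<^sub>R xs - A1 *\<^sub>R w)"
    by (simp add: blinfun.bilinear_simps A1(1) algebra_simps)
  also have "\<dots> = a * blinfun_apply g (xs - vc)"
    unfolding w by (simp add: blinfun.bilinear_simps algebra_simps)
  finally have 3: "A0 * blinfun_apply g (xc - w) + a * blinfun_apply g (xs - w)
      = a * blinfun_apply g (xs - vc)" .
  have v1: "v1 - xs = (vc - xs) - a *\<^sub>R inv B g" by (simp add: v1_def g_def)
  have 4: "(primal_norm B (v1 - xs))\<^sup>2
      = (primal_norm B (vc - xs))\<^sup>2 + 2 * a * blinfun_apply g (xs - vc) + a\<^sup>2 * G"
    using B_sym[of vc "inv B g"] B_sym[of xs "inv B g"]
    unfolding v1 primal_norm_square G_def dual_norm_square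
    by (simp add: B_simps power2_eq_square algebra_simps)
  define D where "D = G / L"
  \<comment> \<open>The gains in \<open>1\<close> and \<open>2\<close> add up to
    \<open>A1 * G / L\<close>; the step-length condition lets them pay for the quadratic term of
    \<open>4\<close>.\<close>
  have "a\<^sup>2 * G \<le> 2 * (A1 / L) * G"
    using A1(2) L_pos by (intro mult_right_mono) (auto simp: G_def field_simps)
  then have 5: "a\<^sup>2 * G \<le> 2 * A1 * D" by (simp add: D_def)
  show ?thesis
    using 1 2 3 4 5 unfolding D_def[symmetric] by (simp add: A1(1) algebra_simps add_divide_distrib)
qed

end

theorem mainTheorem12:
  fixes B :: "'a::euclidean_space \<Rightarrow> ('a \<Rightarrow>\<^sub>L real)"
    and f :: "'a \<Rightarrow> real"
    and L\<^sub>f :: real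
    and a A :: "nat \<Rightarrow> real"
    and x y v :: "nat \<Rightarrow> 'a"
    and xstar :: 'a
    and k :: nat
  assumes "sym_pos_def B"
    and "convex_on UNIV f"
    and "\<And>z. f differentiable (at z)"
    and "L\<^sub>f > 0"
    and "\<And>z w. dual_norm B (gradient f z - gradient f w) \<le> L\<^sub>f * primal_norm B (z - w)"
    and "minimizers f \<noteq> {}"
    and "v 0 = x 0"
    and "A 0 = 0"
    and "\<And>i. i \<ge> 1 \<Longrightarrow> a i = real i / L\<^sub>f"
    and "\<And>i. i \<ge> 1 \<Longrightarrow> A i = real i * (real i + 1) / (2 * L\<^sub>f)"
    and "\<And>i. A (i + 1) *\<^sub>R y (i + 1) = A i *\<^sub>R x i + a (i + 1) *\<^sub>R v i"
    and "\<And>i. x (i + 1) = y (i + 1) - (1 / L\<^sub>f) *\<^sub>R inv B (gradient f (y (i + 1)))"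
    and "\<And>i. v (i + 1) = v i - a (i + 1) *\<^sub>R inv B (gradient f (y (i + 1)))"
    and "xstar \<in> minimizers f"
    and "k \<ge> 1"
  shows "f (x k) - f xstar \<le> L\<^sub>f * (primal_norm B (x 0 - xstar))\<^sup>2 / (real k * (real k + 1))"
proof -
  interpret lipschitz_gradient B f L\<^sub>f
    using assms(1,3,4,5) by unfold_locales auto
  have A: "A i = real i * (real i + 1) / (2 * L\<^sub>f)" for i
    using assms(8,10) by (cases "i = 0") auto
  \<comment> \<open>The unconstrained \<open>y 0\<close> does no harm, since its weight
    \<open>A 0\<close> is 0.\<close>
  let ?P = "\<lambda>i. A i * (surrogate (y i) - f xstar) + (primal_norm B (v i - xstar))\<^sup>2 / 2"
  have a: "a (i + 1) = (real i + 1) / L\<^sub>f" for i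
    using assms(9)[of "i + 1"] by simp
  have "?P (i + 1) \<le> ?P i" for i
    unfolding assms(13)
  proof (rule potential_step[OF assms(2,14)])
    show "A (i + 1) *\<^sub>R y (i + 1) = A i *\<^sub>R x i + a (i + 1) *\<^sub>R v i" by (rule assms(11))
    show "A i = 0 \<or> x i = y i - (1 / L\<^sub>f) *\<^sub>R inv B (gradient f (y i))"
      using assms(8) assms(12)[of "i - 1"] by (cases i) auto
    \<comment> \<open>Multiplied by \<open>L\<^sub>f\<close>, the last inequality reads
      \<open>(i + 1)\<^sup>2 \<le> (i + 1) * (i + 2)\<close>.\<close>
    show "0 \<le> A i" "0 \<le> a (i + 1)" "A (i + 1) = A i + a (i + 1)"
      "L\<^sub>f * (a (i + 1))\<^sup>2 \<le> 2 * A (i + 1)"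
      unfolding a A using L_pos by (simp_all add: field_simps power2_eq_square)
  qed
  then have "?P k \<le> ?P 0"
    by (induction k) (auto intro: order_trans)
  \<comment> \<open>Here \<open>k \<ge> 1\<close> matters: only then is \<open>x k\<close> the
    gradient step from \<open>y k\<close>.\<close>
  moreover have "f (x k) \<le> surrogate (y k)"
    using gradient_step_le_surrogate[of "y k"] assms(12)[of "k - 1"] assms(15) by simp
  then have "A k * (f (x k) - f xstar) \<le> A k * (surrogate (y k) - f xstar)"
    using L_pos by (intro mult_left_mono) (auto simp: A)
  ultimately have "A k * (f (x k) - f xstar) \<le> (primal_norm B (x 0 - xstar))\<^sup>2 / 2"
    unfolding assms(7,8) using zero_le_power2[of "primal_norm B (v k - xstar)"] by linarith
  moreover have "0 < real k * (real k + 1)" using assms(15) by simp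
  ultimately show ?thesis
    using L_pos by (simp only: pos_le_divide_eq A) (simp add: field_simps)
qed

end
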